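(* Let $N\ge 1$, let $f_1,\dots,f_N:\mathbb{R}\to\mathbb{R}$ be convex functions, let $X_1,\dots,X_N\subseteq\mathbb{R}$ be closed convex sets such that $\mathrm{int}\,X=\bigcap_{i=1}^N\mathrm{int}\,X_i$ is nonempty, where $X=\bigcap_{i=1}^N X_i$, let $f(x)=\sum_{i=1}^N f_i(x)$, and assume that $f^*=\min_{x\in X}f(x)$ is finite and $\mathcal{X}^*=\{x\in X: f(x)=f^*\}$ is nonempty. Let $\mathcal{G}$ be a connected weighted undirected graph on $\{1,\dots,N\}$ with Laplacian $L$. Let $\alpha_k,\varepsilon_k>0$ satisfy $$\sum_{k=1}^\infty\alpha_k=\infty,\qquad \sum_{k=1}^\infty\alpha_k^2<\infty,\qquad \sum_{k=1}^\infty\alpha_k\varepsilon_k<\infty .$$ Let $\mathbf{z}(k)=(\mathbf{x}(k),\mathbf{v}(k))$, $k\ge1$, be a sequence generated by the projected primal-dual $\varepsilon$-subgradient algorithm $$x_i(k+1)=P_{X_i}\big[x_i(k)-\alpha_k\big(g_i(k)+\hat x_i(k)+\hat v_i(k)\big)\big],\qquad v_i(k+1)=v_i(k)+\alpha_k\hat x_i(k),\qquad i=1,\dots,N,$$ with $g_i(k)\in\partial_{\varepsilon_k}f_i(x_i(k))$, and suppose there is $C>0$ such that $\max_{1\le i\le N}|g_i(k)|<C$ for all $k\ge1$. Let $\mathbf{z}^*=(\mathbf{x}^*,\mathbf{v}^* )$ be a saddle point of $\Phi$ in $\tilde X\times\mathbb{R}^N$. Then: 1) the sequence $\{\|\mathbf{z}(k+1)-\mathbf{z}^*\|\}$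 converges; 2) $\lim_{k\to\infty}[x_i(k)-x_j(k)]=0$ for all $i,j\in\{1,\dots,N\}$, and $\lim_{k\to\infty}\tilde f(\mathbf{x}(k))=\tilde f(\mathbf{x}^* )=f^*$; 3) $\{\mathbf{z}(k)\}$ has at least one cluster point $\bar{\mathbf{z}}=(\bar{\mathbf{x}},\bar{\mathbf{v}})$ such that $\bar{\mathbf{x}}=\mathbf{1}_N x^*$ with $x^*\in\mathcal{X}^*$; 4) if $\mathcal{X}^*=\{x^*\}$ is a singleton, then $\lim_{k\to\infty}x_i(k)=x^*$ for each $i\in\{1,\dots,N\}$.
   Context: Graph: $\mathcal{G}$ has symmetric weights $a_{ij}=a_{ji}\ge0$, $a_{ii}=0$, with $a_{ij}>0$ iff there is an edge between $i$ and $j$. Its Laplacian $L=[l_{ij}]\in\mathbb{R}^{N\times N}$ is $l_{ii}=\sum_{j\ne i}a_{ij}$, $l_{ij}=-a_{ij}$ for $j\neq i$. $\varepsilon$-subgradient: for a convex $f:\mathbb{R}^m\to\mathbb{R}$ and $\varepsilon>0$, a vector $g$ is an $\varepsilon$-subgradient of $f$ at $x$ if $f(y)\ge f(x)+g^\top(y-x)-\varepsilon$ for all $y\in\mathbb{R}^m$; $\partial_\varepsilon f(x)$ is the set of all $\varepsilon$-subgradients of $f$ at $x$. $P_{X_i}$ is the Euclidean projection onto the closed convex set $X_i$; $\mathbf{1}_N\in\mathbb{R}^N$ is the all-ones vector; $\|\cdot\|$ is the Euclidean norm. Notation: $\mathbf{x}=(x_1,\dots,x_N)^\top$, $\mathbf{v}=(v_1,\dots,v_N)^\top\in\mathbb{R}^N$,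 $\tilde X=X_1\times\cdots\times X_N$, $\tilde f(\mathbf{x})=\sum_{i=1}^N f_i(x_i)$, $\hat x_i(k)=\sum_{j=1}^N a_{ij}(x_i(k)-x_j(k))$, $\hat v_i(k)=\sum_{j=1}^N a_{ij}(v_i(k)-v_j(k))$. The initial values $\mathbf{x}(1),\mathbf{v}(1)$ are given. Augmented Lagrangian: $\Phi(\mathbf{x},\mathbf{v})=\tilde f(\mathbf{x})+\mathbf{v}^\top L\mathbf{x}+\tfrac12\mathbf{x}^\top L\mathbf{x}$. A pair $(\mathbf{x}^*,\mathbf{v}^* )\in\tilde X\times\mathbb{R}^N$ is a saddle point of $\Phi$ in $\tilde X\times\mathbb{R}^N$ if $\Phi(\mathbf{x}^*,\mathbf{v})\le\Phi(\mathbf{x}^*,\mathbf{v}^* )\le\Phi(\mathbf{x},\mathbf{v}^* )$ for all $\mathbf{x}\in\tilde X$, $\mathbf{v}\in\mathbb{R}^N$. *)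

theory Defs
  imports "HOL-Analysis.Analysis"
begin

text \<open>The agents are the elements of a finite index type; vectors with one real
  entry per agent live in \<^typ>\<open>real ^ 'n\<close>.\<close>

definition weighted_undirected_graph :: "('n \<Rightarrow> 'n \<Rightarrow> real) \<Rightarrow> bool" where
  "weighted_undirected_graph a \<longleftrightarrow>
     (\<forall>i j. a i j = a j i) \<and> (\<forall>i j. 0 \<le> a i j) \<and> (\<forall>i. a i i = 0)"

definition graph_edges :: "('n \<Rightarrow> 'n \<Rightarrow> real) \<Rightarrow> ('n \<times> 'n) set" where
  "graph_edges a = {(i, j). 0 < a i j}"

definition connected_graph :: "('n \<Rightarrow> 'n \<Rightarrow> real) \<Rightarrow> bool" where
  "connected_graph a \<longleftrightarrow> (\<forall>i j. (i, j) \<in> (graph_edges a)\<^sup>*)"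

definition laplacian :: "('n::finite \<Rightarrow> 'n \<Rightarrow> real) \<Rightarrow> real ^ 'n ^ 'n" where
  "laplacian a = (\<chi> i j. if i = j then (\<Sum>l\<in>UNIV - {i}. a i l) else - a i j)"

definition eps_subdifferential ::
    "real \<Rightarrow> ('a::real_inner \<Rightarrow> real) \<Rightarrow> 'a \<Rightarrow> 'a set" where
  "eps_subdifferential e h x = {g. \<forall>y. h y \<ge> h x + g \<bullet> (y - x) - e}"

definition disagreement :: "('n::finite \<Rightarrow> 'n \<Rightarrow> real) \<Rightarrow> real ^ 'n \<Rightarrow> 'n \<Rightarrow> real" where
  "disagreement a y i = (\<Sum>j\<in>UNIV. a i j * (y $ i - y $ j))"

definition common_cost :: "('n::finite \<Rightarrow> real \<Rightarrow> real) \<Rightarrow> real \<Rightarrow> real" where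
  "common_cost f x = (\<Sum>i\<in>UNIV. f i x)"

definition separable_cost :: "('n::finite \<Rightarrow> real \<Rightarrow> real) \<Rightarrow> real ^ 'n \<Rightarrow> real" where
  "separable_cost f x = (\<Sum>i\<in>UNIV. f i (x $ i))"

definition product_constraint :: "('n::finite \<Rightarrow> real set) \<Rightarrow> (real ^ 'n) set" where
  "product_constraint X = {x. \<forall>i. x $ i \<in> X i}"

lemma interior_INT_finite:
  fixes X :: "'n::finite \<Rightarrow> 'a::topological_space set"
  shows "interior (\<Inter>i. X i) = (\<Inter>i. interior (X i))"
proof (rule interior_unique)
  show "open (\<Inter>i. interior (X i))"
    by (intro open_INT) auto
  show "(\<Inter>i. interior (X i)) \<subseteq> (\<Inter>i. X i)"
    by (rule INF_mono) (metis interior_subset)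
  show "T \<subseteq> (\<Inter>i. interior (X i))" if "T \<subseteq> (\<Inter>i. X i)" "open T" for T
    using that by (simp add: INT_greatest interior_maximal INT_subset_iff)
qed

definition is_min_value :: "('a \<Rightarrow> real) \<Rightarrow> 'a set \<Rightarrow> real \<Rightarrow> bool" where
  "is_min_value h S m \<longleftrightarrow> (\<exists>x\<in>S. h x = m) \<and> (\<forall>x\<in>S. m \<le> h x)"

definition augmented_lagrangian ::
    "('n::finite \<Rightarrow> 'n \<Rightarrow> real) \<Rightarrow> ('n \<Rightarrow> real \<Rightarrow> real) \<Rightarrow> real ^ 'n \<Rightarrow> real ^ 'n \<Rightarrow> real" where
  "augmented_lagrangian a f x v =
     separable_cost f x + v \<bullet> (laplacian a *v x) + 1/2 * (x \<bullet> (laplacian a *v x))"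

definition saddle_point ::
    "('a \<Rightarrow> 'b \<Rightarrow> real) \<Rightarrow> 'a set \<Rightarrow> 'b set \<Rightarrow> 'a \<Rightarrow> 'b \<Rightarrow> bool" where
  "saddle_point \<Phi> A B xs vs \<longleftrightarrow> xs \<in> A \<and> vs \<in> B \<and>
     (\<forall>x\<in>A. \<forall>v\<in>B. \<Phi> xs v \<le> \<Phi> xs vs \<and> \<Phi> xs vs \<le> \<Phi> x vs)"

text \<open>Iterations are numbered from 1; the values of all sequences at index 0 are
  irrelevant. \<^const>\<open>closest_point\<close> is the Euclidean projection for nonempty closed
  convex sets. The starting point is arbitrary and need not be feasible.\<close>

definition primal_dual_eps_subgradient ::
    "('n::finite \<Rightarrow> 'n \<Rightarrow> real) \<Rightarrow> ('n \<Rightarrow> real \<Rightarrow> real) \<Rightarrow> ('n \<Rightarrow> real set) \<Rightarrow>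
     (nat \<Rightarrow> real) \<Rightarrow> (nat \<Rightarrow> real) \<Rightarrow>
     (nat \<Rightarrow> real ^ 'n) \<Rightarrow> (nat \<Rightarrow> real ^ 'n) \<Rightarrow> (nat \<Rightarrow> real ^ 'n) \<Rightarrow> bool" where
  "primal_dual_eps_subgradient a f X \<alpha> \<epsilon> g x v \<longleftrightarrow> (\<forall>k\<ge>1. \<forall>i.
     g k $ i \<in> eps_subdifferential (\<epsilon> k) (f i) (x k $ i) \<and>
     x (k + 1) $ i = closest_point (X i)
       (x k $ i - \<alpha> k * (g k $ i + disagreement a (x k) i + disagreement a (v k) i)) \<and>
     v (k + 1) $ i = v k $ i + \<alpha> k * disagreement a (x k) i)"

definition seq_cluster_point :: "(nat \<Rightarrow> 'a::topological_space) \<Rightarrow> 'a \<Rightarrow> bool" where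
  "seq_cluster_point z l \<longleftrightarrow> (\<exists>r::nat \<Rightarrow> nat. strict_mono r \<and> (z \<circ> r) \<longlonglongrightarrow> l)"

end

theory Submission
  imports Defs
begin

text \<open>Let \<open>V\<^sub>k = \<parallel>z(k) - z\<^sup>*\<parallel>\<^sup>2\<close> and \<open>D\<^sub>k = \<Phi>(x(k), v\<^sup>*) - \<Phi>(x\<^sup>*, v\<^sup>*) + 1/2 x(k)\<^sup>T L x(k) \<ge> 0\<close>.
  Nonexpansiveness of the projections gives
  \<open>V\<^sub>k\<^sub>+\<^sub>1 \<le> (1 + Q\<alpha>\<^sub>k\<^sup>2) V\<^sub>k - 2\<alpha>\<^sub>k D\<^sub>k + c\<^sub>k\<close> with summable \<open>c\<close>, so \<open>V\<close> converges and
  \<open>\<alpha>\<^sub>k D\<^sub>k\<close> is summable. As \<open>D\<close> grows by at most a multiple of \<open>\<alpha>\<^sub>k\<close> per step, \<open>D\<close> tends to \<open>0\<close>;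
  hence so do both of its nonnegative parts, which gives consensus and convergence of the cost,
  and the remaining claims follow by compactness.\<close>

section \<open>Real sequences with summable perturbations\<close>

text \<open>A deterministic form of the Robbins-Siegmund lemma. Since \<open>1 + b k\<close> is at
  most \<open>exp (b k)\<close>, the product of the growth factors stays below
  \<open>exp (suminf b)\<close> and \<open>V\<close> is bounded; telescoping then gives both
  conclusions.\<close>

lemma robbins_siegmund:
  fixes V w b c :: "nat \<Rightarrow> real"
  assumes step: "\<And>k. V (Suc k) \<le> (1 + b k) * V k - w k + c k"
    and nonneg: "\<And>k. 0 \<le> V k" "\<And>k. 0 \<le> w k" "\<And>k. 0 \<le> b k" "\<And>k. 0 \<le> c k"
    and b: "summable b" and c: "summable c"
  shows "convergent V" and "summable w"
proof -
  define M where "M = exp (suminf b) * (V 0 + suminf c)"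
  have "V k \<le> exp (\<Sum>i<k. b i) * (V 0 + (\<Sum>i<k. c i))" for k
  proof (induction k)
    case (Suc k)
    have "V (Suc k) \<le> (1 + b k) * V k + c k"
      using step[of k] nonneg(2)[of k] by linarith
    also have "\<dots> \<le> exp (b k) * (exp (\<Sum>i<k. b i) * (V 0 + (\<Sum>i<k. c i)))
        + exp (\<Sum>i<Suc k. b i) * c k"
    proof (intro add_mono mult_mono Suc.IH)
      show "1 + b k \<le> exp (b k)"
        by simp
      show "c k \<le> exp (\<Sum>i<Suc k. b i) * c k"
        using nonneg mult_right_mono[of 1 "exp (\<Sum>i<Suc k. b i)" "c k"]
        by (simp add: sum_nonneg add_nonneg_nonneg)
    qed (use nonneg in auto)
    also have "\<dots> = exp (\<Sum>i<Suc k. b i) * (V 0 + (\<Sum>i<Suc k. c i))"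
      by (simp add: exp_add algebra_simps)
    finally show ?case .
  qed simp
  moreover have "exp (\<Sum>i<k. b i) * (V 0 + (\<Sum>i<k. c i)) \<le> M" for k
    unfolding M_def using sum_le_suminf[OF b, of "{..<k}"] sum_le_suminf[OF c, of "{..<k}"]
      sum_nonneg[of "{..<k}" c] nonneg
    by (intro mult_mono add_mono) (auto intro: add_nonneg_nonneg)
  ultimately have VM: "V k \<le> M" for k
    by (meson order_trans)
  \<comment> \<open>Once \<open>V\<close> is bounded by \<open>M\<close>, the multiplicative error
    \<open>b k * V k\<close> is dominated by a summable additive one.\<close>
  define d where "d k = b k * M + c k" for k
  have d: "summable d" "\<And>k. 0 \<le> d k"
    unfolding d_def using b c nonneg VM[of 0]
    by (auto intro!: summable_add summable_mult2 add_nonneg_nonneg mult_nonneg_nonneg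
        intro: order_trans)
  have Vd: "V (Suc k) + w k \<le> V k + d k" for k
    using step[of k] mult_left_mono[OF VM, OF nonneg(3), of k k] by (simp add: d_def algebra_simps)
  have ws: "(\<Sum>i<k. w i) \<le> V 0 - V k + (\<Sum>i<k. d i)" for k
  proof (induction k)
    case (Suc k)
    then show ?case
      using Vd[of k] by simp
  qed simp
  show "summable w"
  proof (rule bounded_imp_summable)
    show "(\<Sum>i\<le>k. w i) \<le> V 0 + suminf d" for k
      using ws[of "Suc k"] nonneg(1)[of "Suc k"] sum_le_suminf[OF d(1), of "{..<Suc k}"] d(2)
      by (simp add: lessThan_Suc_atMost)
  qed (use nonneg in auto)
  \<comment> \<open>Subtracting the accumulated perturbation leaves a decreasing sequence, bounded
    below because \<open>V\<close> is nonnegative and \<open>d\<close> is summable.\<close>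
  define U where "U k = V k - (\<Sum>i<k. d i)" for k
  have U: "decseq U"
  proof (rule decseq_SucI)
    show "U (Suc k) \<le> U k" for k
      using Vd[of k] nonneg(2)[of k] by (simp add: U_def)
  qed
  have "- suminf d \<le> U k" for k
    using nonneg(1)[of k] sum_le_suminf[OF d(1), of "{..<k}"] d(2) by (simp add: U_def)
  then obtain l where "U \<longlonglongrightarrow> l"
    using decseq_convergent[OF U] by metis
  then have "(\<lambda>k. U k + (\<Sum>i<k. d i)) \<longlonglongrightarrow> l + suminf d"
    using d(1) by (intro tendsto_add summable_LIMSEQ)
  then show "convergent V"
    by (auto simp: U_def convergent_def)
qed

text \<open>Squaring turns the one-sided growth bound into a summable perturbation:
  \<open>D\<^sub>k\<^sub>+\<^sub>1\<^sup>2 \<le> D\<^sub>k\<^sup>2 + 2K\<alpha>\<^sub>kD\<^sub>k + K\<^sup>2\<alpha>\<^sub>k\<^sup>2\<close>, so \<open>D\<close> converges.\<close>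

lemma weighted_summable_tendsto_0:
  fixes D \<alpha> :: "nat \<Rightarrow> real"
  assumes D: "\<And>k. 0 \<le> D k" and \<alpha>: "\<And>k. 0 \<le> \<alpha> k"
    and growth: "\<And>k. D (Suc k) \<le> D k + K * \<alpha> k"
    and "\<not> summable \<alpha>" and sq: "summable (\<lambda>k. (\<alpha> k)\<^sup>2)" and sD: "summable (\<lambda>k. \<alpha> k * D k)"
    and K: "0 \<le> K"
  shows "D \<longlonglongrightarrow> 0"
proof -
  have "convergent (\<lambda>k. (D k)\<^sup>2)"
  proof (rule robbins_siegmund(1)[where b = "\<lambda>_. 0" and w = "\<lambda>_. 0"
        and c = "\<lambda>k. 2 * K * (\<alpha> k * D k) + K\<^sup>2 * (\<alpha> k)\<^sup>2"])
    show "(D (Suc k))\<^sup>2 \<le> (1 + 0) * (D k)\<^sup>2 - 0 + (2 * K * (\<alpha> k * D k) + K\<^sup>2 * (\<alpha> k)\<^sup>2)" for k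
      using power_mono[OF growth D, of k 2] by (simp add: power2_eq_square algebra_simps)
  qed (use D \<alpha> K sq sD in \<open>auto intro!: summable_add summable_mult add_nonneg_nonneg\<close>)
  then obtain m where "(\<lambda>k. (D k)\<^sup>2) \<longlonglongrightarrow> m"
    by (auto simp: convergent_def)
  then have "(\<lambda>k. sqrt ((D k)\<^sup>2)) \<longlonglongrightarrow> sqrt m"
    by (rule tendsto_real_sqrt)
  then have lim: "D \<longlonglongrightarrow> sqrt m"
    using D by simp
  \<comment> \<open>A positive limit of \<open>D\<close> would eventually bound
    \<open>\<alpha> k\<close> by a multiple of the summable \<open>\<alpha> k * D k\<close>, making
    the step sizes summable.\<close>
  have "sqrt m = 0"
  proof (rule ccontr)
    assume "sqrt m \<noteq> 0"
    moreover have "0 \<le> sqrt m"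
      using lim D by (meson LIMSEQ_le_const)
    ultimately have pos: "0 < sqrt m / 2" "sqrt m / 2 < sqrt m"
      by auto
    from order_tendstoD(1)[OF lim pos(2)]
    have "eventually (\<lambda>k. norm (\<alpha> k) \<le> 1 / (sqrt m / 2) * (\<alpha> k * D k)) sequentially"
    proof eventually_elim
      case (elim k)
      then have "\<alpha> k * (sqrt m / 2) \<le> \<alpha> k * D k"
        using \<alpha> by (intro mult_left_mono) auto
      then show ?case
        using pos \<alpha>[of k] by (simp add: field_simps)
    qed
    then have "summable \<alpha>"
      by (rule summable_comparison_test_ev) (intro summable_mult sD)
    then show False
      using assms by blast
  qed
  then show ?thesis
    using lim by simp
qed

section \<open>Convex functions on bounded intervals\<close>

text \<open>Chord slopes of a convex function increase from left to right, so every slope inside the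
  interval lies between that of a fixed unit chord to its left and one to its right. Adding the
  absolute values of these two slopes gives the constant.\<close>

lemma convex_on_UNIV_lipschitz_bounded:
  fixes h :: "real \<Rightarrow> real"
  assumes h: "convex_on UNIV h"
  obtains K where "0 \<le> K" "\<And>s t. \<bar>s\<bar> \<le> R \<Longrightarrow> \<bar>t\<bar> \<le> R \<Longrightarrow> \<bar>h s - h t\<bar> \<le> K * \<bar>s - t\<bar>"
proof
  let ?K = "\<bar>h (R + 1) - h (R + 2)\<bar> + \<bar>h (- R - 1) - h (- R - 2)\<bar>"
  show "0 \<le> ?K"
    by simp
  have slope: "(h s - h t) / (s - t) \<le> (h t - h u) / (t - u)" if "s < t" "t < u" for s t u
    using convex_on_slope_le[OF h, of s u t] that by simp
  have less: "\<bar>h s - h t\<bar> \<le> ?K * \<bar>s - t\<bar>" if "s < t" "\<bar>s\<bar> \<le> R" "\<bar>t\<bar> \<le> R" for s t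
  proof -
    have "(h s - h t) / (s - t) \<le> (h t - h (R + 1)) / (t - (R + 1))"
      using that by (intro slope) auto
    also have "\<dots> \<le> (h (R + 1) - h (R + 2)) / ((R + 1) - (R + 2))"
      using that by (intro slope) auto
    finally have up: "(h s - h t) / (s - t) \<le> ?K"
      by simp
    have "(h (- R - 2) - h (- R - 1)) / ((- R - 2) - (- R - 1)) \<le> (h (- R - 1) - h s) / ((- R - 1) - s)"
      using that by (intro slope) auto
    also have "\<dots> \<le> (h s - h t) / (s - t)"
      using that by (intro slope) auto
    finally have "- ?K \<le> (h s - h t) / (s - t)"
      by simp
    with up have "\<bar>(h s - h t) / (s - t)\<bar> \<le> ?K"
      by (intro abs_leI) linarith+
    then show ?thesis
      using that(1) by (simp add: abs_divide divide_le_eq)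
  qed
  show "\<bar>h s - h t\<bar> \<le> ?K * \<bar>s - t\<bar>" if "\<bar>s\<bar> \<le> R" "\<bar>t\<bar> \<le> R" for s t
    using less[of s t] less[of t s] that by (cases s t rule: linorder_cases) (auto simp: abs_minus_commute)
qed

section \<open>The graph Laplacian and consensus\<close>

lemma laplacian_mult_nth: "(laplacian a *v y) $ i = disagreement a y i"
proof -
  have "(laplacian a *v y) $ i
      = (\<Sum>l\<in>UNIV - {i}. a i l) * y $ i + (\<Sum>j\<in>UNIV - {i}. - a i j * y $ j)"
    by (simp add: matrix_vector_mult_def laplacian_def sum.remove[of UNIV i])
  also have "\<dots> = (\<Sum>j\<in>UNIV - {i}. a i j * (y $ i - y $ j))"
    by (simp add: sum_distrib_right right_diff_distrib sum_subtractf sum_negf)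
  also have "\<dots> = disagreement a y i"
    by (simp add: disagreement_def sum.remove[of UNIV i])
  finally show ?thesis .
qed

lemma laplacian_const: "laplacian a *v (\<chi> i. c) = 0"
  by (simp add: vec_eq_iff laplacian_mult_nth disagreement_def)

lemma laplacian_inner_commute:
  assumes "weighted_undirected_graph a"
  shows "y \<bullet> (laplacian a *v z) = z \<bullet> (laplacian a *v y)"
proof -
  have "transpose (laplacian a) = laplacian a"
    using assms by (auto simp: transpose_def laplacian_def vec_eq_iff weighted_undirected_graph_def)
  then show ?thesis
    by (metis dot_lmul_matrix inner_commute transpose_matrix_vector)
qed

text \<open>Adding the double sum to its copy with \<open>i\<close> and \<open>j\<close> exchanged
  completes the square; the factor 1/2 undoes this doubling.\<close>

lemma laplacian_quadratic_form:
  assumes "weighted_undirected_graph a"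
  shows "y \<bullet> (laplacian a *v y) = (\<Sum>i\<in>UNIV. \<Sum>j\<in>UNIV. a i j * (y $ i - y $ j)\<^sup>2) / 2"
proof -
  have sym: "a i j = a j i" for i j
    using assms by (simp add: weighted_undirected_graph_def)
  let ?S = "\<Sum>i\<in>UNIV. \<Sum>j\<in>UNIV. y $ i * (a i j * (y $ i - y $ j))"
  have S: "y \<bullet> (laplacian a *v y) = ?S"
    by (simp add: inner_vec_def laplacian_mult_nth disagreement_def sum_distrib_left)
  have "?S = (\<Sum>i\<in>UNIV. \<Sum>j\<in>UNIV. y $ j * (a i j * (y $ j - y $ i)))"
    by (subst sum.swap) (simp add: sym)
  then have "?S + ?S = (\<Sum>i\<in>UNIV. \<Sum>j\<in>UNIV. y $ i * (a i j * (y $ i - y $ j)))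
      + (\<Sum>i\<in>UNIV. \<Sum>j\<in>UNIV. y $ j * (a i j * (y $ j - y $ i)))"
    by simp
  also have "\<dots> = (\<Sum>i\<in>UNIV. \<Sum>j\<in>UNIV. a i j * (y $ i - y $ j)\<^sup>2)"
    unfolding sum.distrib[symmetric]
    by (intro sum.cong refl) (simp add: power2_eq_square algebra_simps)
  finally show ?thesis
    using S by simp
qed

lemma laplacian_quadratic_form_nonneg:
  assumes "weighted_undirected_graph a"
  shows "0 \<le> y \<bullet> (laplacian a *v y)"
  using assms unfolding laplacian_quadratic_form[OF assms] weighted_undirected_graph_def
  by (intro divide_nonneg_nonneg sum_nonneg mult_nonneg_nonneg) auto

text \<open>The quadratic form dominates the squared difference across each single edge, up to the
  weight of that edge; connectedness then adds the differences along a path.\<close>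

lemma consensus_of_quadratic_form_tendsto_0:
  assumes a: "weighted_undirected_graph a" and conn: "connected_graph a"
    and lim: "(\<lambda>k. y k \<bullet> (laplacian a *v y k)) \<longlonglongrightarrow> 0"
  shows "(\<lambda>k. y k $ i - y k $ j) \<longlonglongrightarrow> 0"
proof -
  have edge: "(\<lambda>k. y k $ p - y k $ q) \<longlonglongrightarrow> 0" if "0 < a p q" for p q
  proof -
    have nn: "0 \<le> a i j" for i j
      using a by (simp add: weighted_undirected_graph_def)
    have bound: "(y k $ p - y k $ q)\<^sup>2 \<le> 2 / a p q * (y k \<bullet> (laplacian a *v y k))" for k
    proof -
      have "a p q * (y k $ p - y k $ q)\<^sup>2 \<le> (\<Sum>j\<in>UNIV. a p j * (y k $ p - y k $ j)\<^sup>2)"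
        using nn by (intro member_le_sum) auto
      also have "\<dots> \<le> (\<Sum>i\<in>UNIV. \<Sum>j\<in>UNIV. a i j * (y k $ i - y k $ j)\<^sup>2)"
        using nn by (intro member_le_sum[where f = "\<lambda>i. \<Sum>j\<in>UNIV. a i j * (y k $ i - y k $ j)\<^sup>2"])
          (auto intro: sum_nonneg)
      finally show ?thesis
        using that unfolding laplacian_quadratic_form[OF a] by (simp add: field_simps)
    qed
    have "(\<lambda>k. (y k $ p - y k $ q)\<^sup>2) \<longlonglongrightarrow> 0"
      by (rule tendsto_sandwich[OF _ always_eventually[OF allI[OF bound]] tendsto_const
            tendsto_mult_right_zero[OF lim]]) simp
    then show ?thesis
      by simp
  qed
  have "(i, j) \<in> (graph_edges a)\<^sup>*"
    using conn by (simp add: connected_graph_def)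
  then show ?thesis
  proof (induction rule: rtrancl_induct)
    case (step p q)
    then have "(\<lambda>k. y k $ p - y k $ q) \<longlonglongrightarrow> 0"
      by (intro edge) (simp add: graph_edges_def)
    from tendsto_add[OF step.IH this] show ?case
      by simp
  qed simp
qed

text \<open>A kernel vector has zero quadratic form, so the consensus result applies to the constant
  sequence with that value.\<close>

lemma laplacian_kernel:
  assumes "weighted_undirected_graph a" "connected_graph a" "laplacian a *v y = 0"
  shows "y $ i = y $ j"
proof -
  have "(\<lambda>k::nat. y $ i - y $ j) \<longlonglongrightarrow> 0"
    using consensus_of_quadratic_form_tendsto_0[of a "\<lambda>_. y" i j] assms by simp
  then show ?thesis
    by (simp add: LIMSEQ_const_iff)
qed

section \<open>Estimates for the Lagrangian and for one iteration\<close>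

text \<open>\<open>F\<close> carries the full quadratic form, where
  \<open>augmented_lagrangian\<close> has half of it, because this is the combination produced by
  one iteration. The bound limits the growth of the gap per step.\<close>

lemma lagrangian_lipschitz_bounded:
  fixes f :: "'n::finite \<Rightarrow> real \<Rightarrow> real" and w :: "real ^ 'n"
  assumes f: "\<And>i. convex_on UNIV (f i)" and a: "weighted_undirected_graph a"
  defines "F \<equiv> \<lambda>y. separable_cost f y + w \<bullet> (laplacian a *v y) + y \<bullet> (laplacian a *v y)"
  obtains K where "0 \<le> K"
    "\<And>y z. norm y \<le> R \<Longrightarrow> norm z \<le> R \<Longrightarrow> \<bar>F y - F z\<bar> \<le> K * norm (y - z)"
proof -
  let ?L = "\<lambda>y. laplacian a *v y"
  have "\<exists>K. \<forall>i. 0 \<le> K i \<and>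
      (\<forall>s t. \<bar>s\<bar> \<le> R \<longrightarrow> \<bar>t\<bar> \<le> R \<longrightarrow> \<bar>f i s - f i t\<bar> \<le> K i * \<bar>s - t\<bar>)"
    by (rule choice) (metis convex_on_UNIV_lipschitz_bounded[OF f])
  then obtain K where K: "\<And>i. 0 \<le> K i"
    "\<And>i s t. \<bar>s\<bar> \<le> R \<Longrightarrow> \<bar>t\<bar> \<le> R \<Longrightarrow> \<bar>f i s - f i t\<bar> \<le> K i * \<bar>s - t\<bar>"
    by blast
  obtain B where B: "0 < B" "\<And>y. norm (?L y) \<le> norm y * B"
    using bounded_linear.pos_bounded[OF matrix_vector_mul_bounded_linear] by blast
  show thesis
  proof
    let ?K = "sum K UNIV + norm w * B + 2 * \<bar>R\<bar> * B"
    show "0 \<le> ?K"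
      using K(1) B(1) by (simp add: sum_nonneg)
    fix y z :: "real ^ 'n"
    assume R: "norm y \<le> R" "norm z \<le> R"
    have "\<bar>separable_cost f y - separable_cost f z\<bar> \<le> (\<Sum>i\<in>UNIV. \<bar>f i (y $ i) - f i (z $ i)\<bar>)"
      unfolding separable_cost_def sum_subtractf[symmetric] by (rule sum_abs)
    also have "\<dots> \<le> (\<Sum>i\<in>UNIV. K i * norm (y - z))"
    proof (rule sum_mono)
      fix i
      have "\<bar>f i (y $ i) - f i (z $ i)\<bar> \<le> K i * \<bar>y $ i - z $ i\<bar>"
        using R component_le_norm_cart[of y i] component_le_norm_cart[of z i] by (intro K(2)) auto
      also have "\<dots> \<le> K i * norm (y - z)"
        using component_le_norm_cart[of "y - z" i] K(1) by (intro mult_left_mono) auto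
      finally show "\<bar>f i (y $ i) - f i (z $ i)\<bar> \<le> K i * norm (y - z)" .
    qed
    finally have 1: "\<bar>separable_cost f y - separable_cost f z\<bar> \<le> sum K UNIV * norm (y - z)"
      by (simp add: sum_distrib_right)
    have "\<bar>w \<bullet> ?L (y - z)\<bar> \<le> norm w * (norm (y - z) * B)"
      by (rule order_trans[OF Cauchy_Schwarz_ineq2]) (simp add: B mult_left_mono)
    then have 2: "\<bar>w \<bullet> ?L y - w \<bullet> ?L z\<bar> \<le> norm w * B * norm (y - z)"
      by (simp add: matrix_vector_mult_diff_distrib inner_diff_right mult_ac)
    \<comment> \<open>By symmetry of the Laplacian the quadratic forms differ by
      \<open>(y - z) \<bullet> ?L (y + z)\<close>, as in a difference of squares, so bounding
      \<open>?L (y + z)\<close> is enough.\<close>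
    have "norm (?L (y + z)) \<le> (norm y + norm z) * B"
      using B(1) by (rule order_trans[OF B(2) mult_right_mono[OF norm_triangle_ineq less_imp_le]])
    also have "\<dots> \<le> 2 * \<bar>R\<bar> * B"
      using R B(1) by (intro mult_right_mono) auto
    finally have "\<bar>(y - z) \<bullet> ?L (y + z)\<bar> \<le> norm (y - z) * (2 * \<bar>R\<bar> * B)"
      by (intro order_trans[OF Cauchy_Schwarz_ineq2] mult_left_mono) auto
    moreover have "(y - z) \<bullet> ?L (y + z) = y \<bullet> ?L y - z \<bullet> ?L z"
      using laplacian_inner_commute[OF a, of y z]
      by (simp add: matrix_vector_right_distrib inner_diff_left inner_add_right)
    ultimately have 3: "\<bar>y \<bullet> ?L y - z \<bullet> ?L z\<bar> \<le> 2 * \<bar>R\<bar> * B * norm (y - z)"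
      by (simp add: mult_ac)
    show "\<bar>F y - F z\<bar> \<le> ?K * norm (y - z)"
      using 1 2 3 unfolding F_def distrib_right by linarith
  qed
qed

text \<open>The dual variables cancel from the cross terms: \<open>L\<close> is symmetric and \<open>L xs = 0\<close>.\<close>

lemma primal_dual_step:
  fixes x v g :: "real ^ 'n::finite"
  assumes a: "weighted_undirected_graph a" and Lxs: "laplacian a *v xs = 0"
    and x': "norm (x' - xs) \<le> norm (x - t *\<^sub>R u - xs)"
    and u: "u = g + laplacian a *v x + laplacian a *v v"
    and v': "v' = v + t *\<^sub>R (laplacian a *v x)"
  shows "(norm (x' - xs))\<^sup>2 + (norm (v' - vs))\<^sup>2 \<le> (norm (x - xs))\<^sup>2 + (norm (v - vs))\<^sup>2
    - 2 * t * (g \<bullet> (x - xs) + vs \<bullet> (laplacian a *v x) + x \<bullet> (laplacian a *v x))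
    + t\<^sup>2 * ((norm u)\<^sup>2 + (norm (laplacian a *v x))\<^sup>2)"
proof -
  let ?L = "\<lambda>y. laplacian a *v y"
  have xs0: "xs \<bullet> ?L y = 0" for y
    using laplacian_inner_commute[OF a, of xs y] Lxs by simp
  have "(norm (x' - xs))\<^sup>2 \<le> (norm (x - t *\<^sub>R u - xs))\<^sup>2"
    using x' by (intro power_mono) auto
  also have "\<dots> = (norm (x - xs))\<^sup>2 - 2 * t * (u \<bullet> (x - xs)) + t\<^sup>2 * (norm u)\<^sup>2"
    unfolding power2_norm_eq_inner
    by (simp add: inner_diff_left inner_diff_right inner_commute power2_eq_square algebra_simps)
  finally have 1: "(norm (x' - xs))\<^sup>2
    \<le> (norm (x - xs))\<^sup>2 - 2 * t * (u \<bullet> (x - xs)) + t\<^sup>2 * (norm u)\<^sup>2" .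
  have 2: "(norm (v' - vs))\<^sup>2
    = (norm (v - vs))\<^sup>2 + 2 * t * ((v - vs) \<bullet> ?L x) + t\<^sup>2 * (norm (?L x))\<^sup>2"
    unfolding v' power2_norm_eq_inner
    by (simp add: inner_diff_left inner_diff_right inner_add_left inner_add_right inner_commute
        power2_eq_square algebra_simps)
  have 3: "u \<bullet> (x - xs) = g \<bullet> (x - xs) + x \<bullet> ?L x + v \<bullet> ?L x"
    using laplacian_inner_commute[OF a, of x v] xs0 unfolding u
    by (simp add: inner_diff_right inner_add_left inner_commute[of "?L _"])
  show ?thesis
    using 1 2 unfolding 3 by (simp add: inner_diff_left algebra_simps)
qed

text \<open>The projections are nonexpansive and fix the entries of \<open>y\<close>. It is applied
  both to the saddle point and to the current iterate in the role of \<open>y\<close>.\<close>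

lemma closest_point_vec_contraction:
  fixes X :: "'n::finite \<Rightarrow> real set"
  assumes "\<And>i. closed (X i)" "\<And>i. convex (X i)" "y \<in> product_constraint X"
    and "\<And>i. x' $ i = closest_point (X i) (z $ i)"
  shows "norm (x' - y) \<le> norm (z - y)"
proof (rule norm_le_componentwise_cart)
  fix i
  have yi: "y $ i \<in> X i"
    using assms by (simp add: product_constraint_def)
  then have "dist (closest_point (X i) (z $ i)) (closest_point (X i) (y $ i)) \<le> dist (z $ i) (y $ i)"
    using assms by (intro closest_point_lipschitz) auto
  then show "norm ((x' - y) $ i) \<le> norm ((z - y) $ i)"
    using yi by (simp add: assms(4) closest_point_self dist_norm)
qed

section \<open>Saddle points\<close>

text \<open>Moving the dual variable from \<open>vs\<close> by \<open>laplacian a *v xs\<close>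
  raises the Lagrangian by the squared norm of that vector, which maximality at \<open>vs\<close>
  forbids unless it is zero.\<close>

lemma saddle_point_laplacian_zero:
  assumes "saddle_point (augmented_lagrangian a f) A UNIV xs vs"
  shows "laplacian a *v xs = 0"
proof -
  have "augmented_lagrangian a f xs (vs + laplacian a *v xs) \<le> augmented_lagrangian a f xs vs"
    using assms unfolding saddle_point_def by blast
  then have "(laplacian a *v xs) \<bullet> (laplacian a *v xs) \<le> 0"
    by (simp add: augmented_lagrangian_def inner_add_left)
  then show ?thesis
    by (metis inner_eq_zero_iff inner_ge_zero order_antisym)
qed

lemma separable_cost_const: "separable_cost f (\<chi> i. y) = common_cost f y"
  by (simp add: separable_cost_def common_cost_def)

text \<open>The Laplacian terms vanish at constant vectors. A minimizer repeated in every entry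
  competes with \<open>xs\<close>, giving one inequality; \<open>xs\<close> is itself constant by
  connectedness, with a feasible entry, giving the other.\<close>

lemma saddle_point_cost:
  assumes a: "weighted_undirected_graph a" "connected_graph a"
    and min: "is_min_value (common_cost f) (\<Inter>i. X i) m"
    and saddle: "saddle_point (augmented_lagrangian a f) (product_constraint X) UNIV xs vs"
  shows "separable_cost f xs = m"
proof (rule antisym)
  have Lxs: "laplacian a *v xs = 0"
    by (rule saddle_point_laplacian_zero[OF saddle])
  obtain y where y: "\<And>i. y \<in> X i" "common_cost f y = m"
    using min by (auto simp: is_min_value_def)
  then have "augmented_lagrangian a f xs vs \<le> augmented_lagrangian a f (\<chi> i. y) vs"
    using saddle by (simp add: saddle_point_def product_constraint_def)
  then show "separable_cost f xs \<le> m"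
    by (simp add: augmented_lagrangian_def Lxs laplacian_const separable_cost_const y)
  obtain c where c: "xs = (\<chi> i. c)"
    using laplacian_kernel[OF a Lxs] by (metis vec_lambda_unique)
  then have "c \<in> (\<Inter>i. X i)"
    using saddle by (simp add: saddle_point_def product_constraint_def)
  then show "m \<le> separable_cost f xs"
    using min by (simp add: c separable_cost_const is_min_value_def)
qed

section \<open>Compactness, step directions and subgradients\<close>

text \<open>Without convergence, some subsequence stays a fixed distance away from \<open>l\<close>;
  by compactness it has a cluster point, which cannot be \<open>l\<close>.\<close>

lemma bounded_sequence_tendsto_of_unique_cluster_point:
  fixes y :: "nat \<Rightarrow> 'a::heine_borel"
  assumes bdd: "bounded (range y)"
    and unique: "\<And>m. seq_cluster_point y m \<Longrightarrow> m = l"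
  shows "y \<longlonglongrightarrow> l"
proof (rule ccontr)
  assume "\<not> y \<longlonglongrightarrow> l"
  then obtain e where e: "0 < e" "\<exists>\<^sub>F k in sequentially. e \<le> dist (y k) l"
    unfolding tendsto_iff frequently_def by (force simp: not_less not_le)
  then have "infinite {k. e \<le> dist (y k) l}"
    by (simp add: frequently_cofinite cofinite_eq_sequentially[symmetric])
  then obtain r :: "nat \<Rightarrow> nat" where r: "strict_mono r" "\<And>k. e \<le> dist (y (r k)) l"
    using infinite_enumerate by blast
  have "bounded (range (y \<circ> r))"
    using bdd by (rule bounded_subset) auto
  then obtain m s where s: "strict_mono (s::nat \<Rightarrow> nat)" "((y \<circ> r) \<circ> s) \<longlonglongrightarrow> m"
    using bounded_imp_convergent_subsequence by blast
  have "seq_cluster_point y m"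
    unfolding seq_cluster_point_def
    using s r by (intro exI[of _ "r \<circ> s"]) (auto simp: strict_mono_o o_assoc)
  then have "((y \<circ> r) \<circ> s) \<longlonglongrightarrow> l"
    using s unique by simp
  then have "eventually (\<lambda>k. dist (y (r (s k))) l < e) sequentially"
    using tendstoD[OF _ e(1)] by fastforce
  then show False
    using r(2) by (auto simp: eventually_sequentially not_less[symmetric])
qed

text \<open>The iterates are not yet known to be bounded where this is applied, so the bound is
  allowed to grow with the squared distance. Multiplied by squared step sizes, such growth is a
  summable relative perturbation.\<close>

lemma primal_dual_direction_bound:
  fixes vs xs :: "real ^ 'n::finite"
  assumes Lxs: "laplacian a *v xs = 0"
  obtains Q where "0 \<le> Q"
    "\<And>g x v. norm g \<le> G \<Longrightarrow>
      (norm (g + laplacian a *v x + laplacian a *v v))\<^sup>2 + (norm (laplacian a *v x))\<^sup>2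
      \<le> Q * (1 + ((norm (x - xs))\<^sup>2 + (norm (v - vs))\<^sup>2))"
proof -
  let ?L = "\<lambda>y. laplacian a *v y"
  obtain B where B: "0 < B" "\<And>y. norm (?L y) \<le> norm y * B"
    using bounded_linear.pos_bounded[OF matrix_vector_mul_bounded_linear] by blast
  define P where "P = \<bar>G\<bar> + norm (?L vs)"
  show thesis
  proof
    show "0 \<le> 3 * P\<^sup>2 + 4 * B\<^sup>2"
      by simp
    fix g x v :: "real ^ 'n"
    assume g: "norm g \<le> G"
    let ?p = "norm (x - xs)" and ?q = "norm (v - vs)"
    have x: "norm (?L x) \<le> ?p * B"
      using B(2)[of "x - xs"] by (simp add: matrix_vector_mult_diff_distrib Lxs)
    have v: "norm (?L v) \<le> norm (?L vs) + ?q * B"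
      using B(2)[of "v - vs"] norm_triangle_sub[of "?L v" "?L vs"]
      by (simp add: matrix_vector_mult_diff_distrib)
    have "norm (g + ?L x + ?L v) \<le> P + ?p * B + ?q * B"
      using g x v norm_triangle_ineq[of g "?L x"] norm_triangle_ineq[of "g + ?L x" "?L v"]
      unfolding P_def by linarith
    then have "(norm (g + ?L x + ?L v))\<^sup>2 \<le> (P + ?p * B + ?q * B)\<^sup>2"
      by (intro power_mono) auto
    also have "\<dots> \<le> 3 * (P\<^sup>2 + (?p * B)\<^sup>2 + (?q * B)\<^sup>2)"
      using zero_le_power2[of "P - ?p * B"] zero_le_power2[of "P - ?q * B"]
        zero_le_power2[of "?p * B - ?q * B"]
      by (simp add: power2_eq_square algebra_simps)
    finally have 1: "(norm (g + ?L x + ?L v))\<^sup>2 \<le> 3 * P\<^sup>2 + 3 * B\<^sup>2 * ?p\<^sup>2 + 3 * B\<^sup>2 * ?q\<^sup>2"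
      by (simp add: power_mult_distrib algebra_simps)
    have 2: "(norm (?L x))\<^sup>2 \<le> B\<^sup>2 * ?p\<^sup>2"
      using power_mono[OF x, of 2] by (simp add: power_mult_distrib mult.commute)
    \<comment> \<open>Exactly the terms of the expanded product that \<open>1\<close> and
      \<open>2\<close> leave over.\<close>
    have "0 \<le> 3 * P\<^sup>2 * (?p\<^sup>2 + ?q\<^sup>2) + 4 * B\<^sup>2 + B\<^sup>2 * ?q\<^sup>2"
      by simp
    then show "(norm (g + ?L x + ?L v))\<^sup>2 + (norm (?L x))\<^sup>2
        \<le> (3 * P\<^sup>2 + 4 * B\<^sup>2) * (1 + (?p\<^sup>2 + ?q\<^sup>2))"
      using 1 2 unfolding distrib_left distrib_right by linarith
  qed
qed

text \<open>The defect \<open>e\<close> is incurred once per agent, hence the factor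
  \<open>CARD('n)\<close>.\<close>

lemma eps_subgradient_separable_cost:
  fixes g x y :: "real ^ 'n::finite"
  assumes "\<And>i. g $ i \<in> eps_subdifferential e (f i) (x $ i)"
  shows "separable_cost f x - separable_cost f y - real CARD('n) * e \<le> g \<bullet> (x - y)"
proof -
  have "(\<Sum>i\<in>UNIV. f i (x $ i) - f i (y $ i) - e) \<le> (\<Sum>i\<in>UNIV. g $ i * (x $ i - y $ i))"
  proof (rule sum_mono)
    fix i
    have "f i (y $ i) \<ge> f i (x $ i) + g $ i * (y $ i - x $ i) - e"
      using assms[of i] by (simp add: eps_subdifferential_def)
    then show "f i (x $ i) - f i (y $ i) - e \<le> g $ i * (x $ i - y $ i)"
      by (simp add: algebra_simps)
  qed
  then show ?thesis
    by (simp add: separable_cost_def inner_vec_def sum_subtractf)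
qed

section \<open>Convergence of the primal-dual iteration\<close>

theorem theorem2:
  fixes a :: "'n::finite \<Rightarrow> 'n \<Rightarrow> real"
    and f :: "'n \<Rightarrow> real \<Rightarrow> real"
    and X :: "'n \<Rightarrow> real set"
    and fstar C :: real
    and Xstar :: "real set"
    and \<alpha> \<epsilon> :: "nat \<Rightarrow> real"
    and g x v :: "nat \<Rightarrow> real ^ 'n"
    and xs vs :: "real ^ 'n"
  assumes "\<And>i. convex_on UNIV (f i)"
    and "\<And>i. closed (X i)" and "\<And>i. convex (X i)"
    and "interior (\<Inter>i. X i) \<noteq> {}"
    and "is_min_value (common_cost f) (\<Inter>i. X i) fstar"
    and "Xstar = {y \<in> (\<Inter>i. X i). common_cost f y = fstar}" and "Xstar \<noteq> {}"
    and "weighted_undirected_graph a" and "connected_graph a"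
    and "\<And>k. k \<ge> 1 \<Longrightarrow> \<alpha> k > 0" and "\<And>k. k \<ge> 1 \<Longrightarrow> \<epsilon> k > 0"
    and "filterlim (\<lambda>n. \<Sum>k=1..n. \<alpha> k) at_top sequentially"
    and "summable (\<lambda>k. (\<alpha> (Suc k))\<^sup>2)"
    and "summable (\<lambda>k. \<alpha> (Suc k) * \<epsilon> (Suc k))"
    and "primal_dual_eps_subgradient a f X \<alpha> \<epsilon> g x v"
    and "C > 0" and "\<And>k. k \<ge> 1 \<Longrightarrow> (MAX i. \<bar>g k $ i\<bar>) < C"
    and "saddle_point (augmented_lagrangian a f) (product_constraint X) UNIV xs vs"
  shows "convergent (\<lambda>k. norm ((x (k + 1), v (k + 1)) - (xs, vs))) \<and>
    ((\<forall>i j. (\<lambda>k. x k $ i - x k $ j) \<longlonglongrightarrow> 0) \<and>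
      (\<lambda>k. separable_cost f (x k)) \<longlonglongrightarrow> separable_cost f xs \<and>
      separable_cost f xs = fstar) \<and>
    (\<exists>xbar vbar. seq_cluster_point (\<lambda>k. (x k, v k)) (xbar, vbar) \<and>
      (\<exists>xopt\<in>Xstar. xbar = (\<chi> i. xopt))) \<and>
    (\<forall>xopt. Xstar = {xopt} \<longrightarrow> (\<forall>i. (\<lambda>k. x k $ i) \<longlonglongrightarrow> xopt))"
proof -
  note f = assms(1) and clX = assms(2) and cvxX = assms(3) and min = assms(5) and Xstar = assms(6)
    and a = assms(8) and conn = assms(9) and \<alpha>pos = assms(10) and \<epsilon>pos = assms(11)
    and alg = assms(15) and gC = assms(17) and saddle = assms(18)
  let ?L = "\<lambda>y. laplacian a *v y"
  define u where "u k = g k + ?L (x k) + ?L (v k)" for k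
  have subgrad: "g k $ i \<in> eps_subdifferential (\<epsilon> k) (f i) (x k $ i)"
    and xstep: "x (Suc k) $ i = closest_point (X i) ((x k - \<alpha> k *\<^sub>R u k) $ i)"
    and vstep: "v (Suc k) = v k + \<alpha> k *\<^sub>R ?L (x k)" if "1 \<le> k" for k i
    using alg that
    by (simp_all add: primal_dual_eps_subgradient_def u_def laplacian_mult_nth vec_eq_iff)
  have xs: "xs \<in> product_constraint X"
    using saddle by (simp add: saddle_point_def)
  have Lxs: "?L xs = 0"
    by (rule saddle_point_laplacian_zero[OF saddle])
  have cost_xs: "separable_cost f xs = fstar"
    by (rule saddle_point_cost[OF a conn min saddle])
  have contraction: "norm (x (Suc k) - y) \<le> norm (x k - \<alpha> k *\<^sub>R u k - y)"
    if "1 \<le> k" "y \<in> product_constraint X" for k y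
    using closest_point_vec_contraction[OF clX cvxX that(2)] xstep[OF that(1)] by blast
  have feasible: "x (k + 2) \<in> product_constraint X" for k
  proof -
    have "X i \<noteq> {}" for i
      using xs by (auto simp: product_constraint_def)
    then show ?thesis
      using xstep[of "Suc k"] by (simp add: product_constraint_def closest_point_in_set clX)
  qed

  text \<open>The starting point \<open>x 1\<close> may be infeasible, so indices are shifted by \<open>2\<close>.\<close>

  define F where "F y = separable_cost f y + vs \<bullet> ?L y + y \<bullet> ?L y" for y
  define D where "D k = F (x (k + 2)) - F xs" for k
  define V where "V k = (norm (x (k + 2) - xs))\<^sup>2 + (norm (v (k + 2) - vs))\<^sup>2" for k
  define \<beta> where "\<beta> k = \<alpha> (k + 2)" for k
  have \<beta>: "0 < \<beta> k" for k
    using \<alpha>pos by (simp add: \<beta>_def)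
  have D_eq: "D k = separable_cost f (x (k + 2)) - separable_cost f xs
      + vs \<bullet> ?L (x (k + 2)) + x (k + 2) \<bullet> ?L (x (k + 2))" for k
    by (simp add: D_def F_def Lxs)
  \<comment> \<open>The saddle inequality makes the Lagrangian part of \<open>D\<close> nonnegative,
    which leaves half of the quadratic form as a lower bound.\<close>
  have D_quad: "x (k + 2) \<bullet> ?L (x (k + 2)) \<le> 2 * D k" for k
  proof -
    have "augmented_lagrangian a f xs vs \<le> augmented_lagrangian a f (x (k + 2)) vs"
      using saddle feasible by (simp add: saddle_point_def)
    then show ?thesis
      by (simp add: augmented_lagrangian_def Lxs D_eq)
  qed
  have D_nonneg: "0 \<le> D k" for k
    using D_quad[of k] laplacian_quadratic_form_nonneg[OF a, of "x (k + 2)"] by simp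

  \<comment> \<open>Descent inequality for the squared distance\<close>
  define G where "G = (\<Sum>i\<in>(UNIV::'n set). C)"
  have g_le: "norm (g k) \<le> G" if "1 \<le> k" for k
  proof -
    have "\<bar>g k $ i\<bar> \<le> C" for i
      using gC[OF that] Max_ge[of "range (\<lambda>i. \<bar>g k $ i\<bar>)" "\<bar>g k $ i\<bar>"] by (simp add: less_imp_le)
    then show ?thesis
      unfolding G_def by (intro order_trans[OF norm_le_l1_cart] sum_mono) auto
  qed
  obtain Q where Q: "0 \<le> Q" and Q_bound: "\<And>k.
      (norm (u (k + 2)))\<^sup>2 + (norm (?L (x (k + 2))))\<^sup>2 \<le> Q * (1 + V k)"
  proof (rule primal_dual_direction_bound[OF Lxs, of G vs])
    fix Q
    assume Q: "0 \<le> Q" "\<And>g x v. norm g \<le> G \<Longrightarrow>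
      (norm (g + ?L x + ?L v))\<^sup>2 + (norm (?L x))\<^sup>2
      \<le> Q * (1 + ((norm (x - xs))\<^sup>2 + (norm (v - vs))\<^sup>2))"
    show thesis
      by (rule that[of Q, OF Q(1)], unfold u_def V_def, rule Q(2)[OF g_le]) simp
  qed
  \<comment> \<open>\<open>c\<close> collects the subgradient defect and the constant part of
    \<open>Q * (1 + V k)\<close>; the remaining part goes into the factor in front of
    \<open>V k\<close>.\<close>
  define c where "c k = 2 * real CARD('n) * (\<beta> k * \<epsilon> (k + 2)) + Q * (\<beta> k)\<^sup>2" for k
  have descent: "V (Suc k) \<le> (1 + Q * (\<beta> k)\<^sup>2) * V k - 2 * (\<beta> k * D k) + c k" for k
  proof -
    let ?x = "x (k + 2)" and ?g = "g (k + 2)"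
    have "V (Suc k) \<le> V k - 2 * \<beta> k * (?g \<bullet> (?x - xs) + vs \<bullet> ?L ?x + ?x \<bullet> ?L ?x)
        + (\<beta> k)\<^sup>2 * ((norm (u (k + 2)))\<^sup>2 + (norm (?L ?x))\<^sup>2)"
      unfolding V_def
      using primal_dual_step[OF a Lxs contraction[OF _ xs] u_def vstep, of "k + 2" vs]
      by (simp add: \<beta>_def)
    also have "\<dots> \<le> V k - 2 * \<beta> k * (D k - real CARD('n) * \<epsilon> (k + 2))
        + (\<beta> k)\<^sup>2 * (Q * (1 + V k))"
    proof (intro add_mono diff_mono mult_left_mono Q_bound order_refl)
      show "D k - real CARD('n) * \<epsilon> (k + 2) \<le> ?g \<bullet> (?x - xs) + vs \<bullet> ?L ?x + ?x \<bullet> ?L ?x"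
        using eps_subgradient_separable_cost[OF subgrad, of "k + 2" xs]
        by (simp add: D_eq)
    qed (use \<beta>[of k] in auto)
    finally show ?thesis
      by (simp add: c_def algebra_simps)
  qed

  \<comment> \<open>The hypotheses already start at \<open>Suc k\<close>, so passing to
    \<open>\<beta>\<close> drops just one more term.\<close>
  have sq: "summable (\<lambda>k. (\<beta> k)\<^sup>2)"
    using summable_ignore_initial_segment[OF assms(13), of 1] by (simp add: \<beta>_def)
  have \<beta>\<epsilon>: "summable (\<lambda>k. \<beta> k * \<epsilon> (k + 2))"
    using summable_ignore_initial_segment[OF assms(14), of 1] by (simp add: \<beta>_def)
  have c: "summable c" "\<And>k. 0 \<le> c k"
  proof -
    show "summable c"
      unfolding c_def by (intro summable_add summable_mult sq \<beta>\<epsilon>)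
    show "0 \<le> c k" for k
      using \<epsilon>pos[of "k + 2"] \<beta>[of k] Q by (simp add: c_def)
  qed
  have nonneg: "0 \<le> V k" "0 \<le> 2 * (\<beta> k * D k)" "0 \<le> Q * (\<beta> k)\<^sup>2" for k
    using \<beta>[of k] D_nonneg[of k] Q by (simp_all add: V_def)
  note V_conv = robbins_siegmund[of V "\<lambda>k. Q * (\<beta> k)\<^sup>2",
      OF descent nonneg c(2) summable_mult[OF sq] c(1)]
  obtain l where l: "V \<longlonglongrightarrow> l"
    using V_conv(1) by (auto simp: convergent_def)
  have sD: "summable (\<lambda>k. \<beta> k * D k)"
    using summable_mult[OF V_conv(2), of "1/2"] by simp

  \<comment> \<open>Boundedness of the iterates and decay of \<open>D\<close>\<close>
  obtain M where M: "V k \<le> M" for k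
    using convergent_imp_Bseq[OF V_conv(1)] by (auto simp: Bseq_def abs_le_iff)
  have dist_le: "norm (x (k + 2) - xs) \<le> sqrt M" for k
    using M[of k] by (auto simp: V_def intro!: real_le_rsqrt intro: order_trans[rotated])
  have u_le: "norm (u (k + 2)) \<le> sqrt (Q * (1 + M))" for k
  proof (rule real_le_rsqrt)
    have "Q * (1 + V k) \<le> Q * (1 + M)"
      using M Q by (intro mult_left_mono) auto
    then show "(norm (u (k + 2)))\<^sup>2 \<le> Q * (1 + M)"
      using Q_bound[of k] zero_le_power2[of "norm (?L (x (k + 2)))"] by linarith
  qed
  define R where "R = norm xs + sqrt M"
  have x_le: "norm (x (k + 2)) \<le> R" for k
    using norm_triangle_sub[of "x (k + 2)" xs] dist_le[of k] by (simp add: R_def)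
  obtain K where K: "0 \<le> K"
    "\<And>y z. norm y \<le> R \<Longrightarrow> norm z \<le> R \<Longrightarrow> \<bar>F y - F z\<bar> \<le> K * norm (y - z)"
    by (rule lagrangian_lipschitz_bounded[where f = f and w = vs and R = R, OF f a, folded F_def])
      (rule that)
  have growth: "D (Suc k) \<le> D k + (K * sqrt (Q * (1 + M))) * \<beta> k" for k
  proof -
    \<comment> \<open>The contraction is taken about the feasible point \<open>x (k + 2)\<close>
      itself, so the projected step is no longer than the unprojected one.\<close>
    have "norm (x (Suc (k + 2)) - x (k + 2)) \<le> \<beta> k * norm (u (k + 2))"
      using contraction[OF _ feasible, of "k + 2" k] \<beta>[of k] by (simp add: \<beta>_def)
    also have "\<dots> \<le> \<beta> k * sqrt (Q * (1 + M))"
      using u_le \<beta>[of k] by (intro mult_left_mono) auto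
    finally have "K * norm (x (Suc (k + 2)) - x (k + 2)) \<le> K * (\<beta> k * sqrt (Q * (1 + M)))"
      using K(1) by (intro mult_left_mono)
    then show ?thesis
      using K(2)[of "x (Suc (k + 2))" "x (k + 2)"] x_le[of k] x_le[of "Suc k"]
      by (simp add: D_def mult_ac)
  qed
  have not_summable: "\<not> summable \<beta>"
  proof
    assume "summable \<beta>"
    then have "summable \<alpha>"
      unfolding \<beta>_def by (rule summable_iff_shift[THEN iffD1])
    \<comment> \<open>The divergent sums start at index 1, so \<open>\<alpha> 0\<close> is
      subtracted before comparing.\<close>
    then have "(\<lambda>n. (\<Sum>k\<le>n. \<alpha> k) - \<alpha> 0) \<longlonglongrightarrow> suminf \<alpha> - \<alpha> 0"
      by (intro tendsto_diff summable_LIMSEQ' tendsto_const)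
    also have "(\<lambda>n. (\<Sum>k\<le>n. \<alpha> k) - \<alpha> 0) = (\<lambda>n. \<Sum>k=1..n. \<alpha> k)"
      by (simp add: atMost_atLeast0 sum.atLeast_Suc_atMost)
    finally show False
      using filterlim_at_top_imp_at_infinity[OF assms(12)]
      by (rule not_tendsto_and_filterlim_at_infinity[OF sequentially_bot])
  qed
  have D0: "D \<longlonglongrightarrow> 0"
    by (rule weighted_summable_tendsto_0[OF D_nonneg less_imp_le[OF \<beta>] growth not_summable sq sD])
      (use K(1) Q order_trans[OF nonneg(1) M] in simp)

  \<comment> \<open>Consensus and convergence of the cost\<close>
  have quad0: "(\<lambda>k. x (k + 2) \<bullet> ?L (x (k + 2))) \<longlonglongrightarrow> 0"
    by (rule tendsto_sandwich[OF _ always_eventually[OF allI[OF D_quad]] tendsto_const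
          tendsto_mult_right_zero[OF D0]]) (simp add: laplacian_quadratic_form_nonneg[OF a])
  have "(\<lambda>k. x (k + 2) $ i - x (k + 2) $ j) \<longlonglongrightarrow> 0" for i j
    by (rule consensus_of_quadratic_form_tendsto_0[OF a conn quad0])
  then have consensus: "(\<lambda>k. x k $ i - x k $ j) \<longlonglongrightarrow> 0" for i j
    by (rule LIMSEQ_offset)
  \<comment> \<open>The entries of \<open>?L (x k)\<close> are combinations of differences of
    entries of \<open>x k\<close>, so consensus makes this term vanish.\<close>
  have "(\<lambda>k. vs \<bullet> ?L (x k)) \<longlonglongrightarrow> 0"
  proof -
    have "(\<lambda>k. \<Sum>i\<in>UNIV. vs $ i * (\<Sum>j\<in>UNIV. a i j * (x k $ i - x k $ j))) \<longlonglongrightarrow> 0"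
      by (intro tendsto_null_sum tendsto_mult_right_zero consensus)
    then show ?thesis
      by (simp add: inner_vec_def laplacian_mult_nth disagreement_def)
  qed
  from LIMSEQ_ignore_initial_segment[OF this, of 2]
  have "(\<lambda>k. D k - vs \<bullet> ?L (x (k + 2)) - x (k + 2) \<bullet> ?L (x (k + 2)) + fstar)
      \<longlonglongrightarrow> 0 - 0 - 0 + fstar"
    by (intro tendsto_add tendsto_diff D0 quad0 tendsto_const)
  then have "(\<lambda>k. separable_cost f (x (k + 2))) \<longlonglongrightarrow> fstar"
    by (simp add: D_eq cost_xs)
  then have cost: "(\<lambda>k. separable_cost f (x k)) \<longlonglongrightarrow> fstar"
    by (rule LIMSEQ_offset)

  \<comment> \<open>Cluster points and boundedness\<close>
  \<comment> \<open>Shown for every cluster point: claim 3 then needs only the existence of one, and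
    claim 4 follows from uniqueness.\<close>
  have cluster: "\<exists>xopt\<in>Xstar. xbar = (\<chi> i. xopt)" if xbar: "seq_cluster_point x xbar" for xbar
  proof -
    obtain r :: "nat \<Rightarrow> nat" where r: "strict_mono r" and lim: "(\<lambda>k. x (r k)) \<longlonglongrightarrow> xbar"
      using xbar by (auto simp: seq_cluster_point_def o_def)
    have limi: "(\<lambda>k. x (r k) $ i) \<longlonglongrightarrow> xbar $ i" for i
      using lim by (rule tendsto_vec_nth)
    have "xbar $ i - xbar $ j = 0" for i j
      by (rule LIMSEQ_unique[OF tendsto_diff[OF limi limi]
            LIMSEQ_subseq_LIMSEQ[OF consensus r, unfolded o_def]])
    then obtain y where y: "xbar = (\<chi> i. y)"
      by (metis eq_iff_diff_eq_0 vec_lambda_unique)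
    \<comment> \<open>Feasibility is known from index 2 on; \<open>r (k + 2)\<close> is at least
      \<open>k + 2\<close>, so the shifted subsequence stays in that range.\<close>
    have "y \<in> X i" for i
    proof (rule closed_sequentially[OF clX, of "\<lambda>k. x (r (k + 2)) $ i"])
      show "x (r (k + 2)) $ i \<in> X i" for k
        using feasible[of "r (k + 2) - 2"] seq_suble[OF r, of "k + 2"]
        by (simp add: product_constraint_def del: add_2_eq_Suc')
      show "(\<lambda>k. x (r (k + 2)) $ i) \<longlonglongrightarrow> y"
        using LIMSEQ_ignore_initial_segment[OF limi[of i], of 2] by (simp add: y)
    qed
    moreover have "common_cost f y = fstar"
    proof -
      \<comment> \<open>A convex function on the whole line is continuous, so the cost passes to the
        limit.\<close>
      have "(\<lambda>k. separable_cost f (x (r k))) \<longlonglongrightarrow> separable_cost f xbar"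
        unfolding separable_cost_def
        by (intro tendsto_sum continuous_on_tendsto_compose[OF convex_on_continuous[OF open_UNIV f]] limi)
          auto
      from LIMSEQ_unique[OF this LIMSEQ_subseq_LIMSEQ[OF cost r, unfolded o_def]] show ?thesis
        by (simp add: y separable_cost_const)
    qed
    ultimately show ?thesis
      unfolding Xstar y by blast
  qed

  have bdd: "bounded (range (\<lambda>k. (x k, v k)))"
  proof -
    have "Bseq (\<lambda>k. (x (k + 2), v (k + 2)))"
    proof (rule BseqI')
      fix k
      have "norm ((x (k + 2), v (k + 2)) - (xs, vs)) \<le> sqrt M"
        using M[of k] by (simp add: norm_Pair V_def)
      then show "norm (x (k + 2), v (k + 2)) \<le> norm (xs, vs) + sqrt M"
        using norm_triangle_sub[of "(x (k + 2), v (k + 2))" "(xs, vs)"] by linarith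
    qed
    then have "Bseq (\<lambda>k. (x k, v k))"
      by (rule Bseq_offset)
    then show ?thesis
      by (simp add: Bseq_eq_bounded)
  qed

  \<comment> \<open>The four claims\<close>
  show ?thesis
  proof (intro conjI allI impI)
    have "(\<lambda>k. sqrt (V k)) \<longlonglongrightarrow> sqrt l"
      using l by (rule tendsto_real_sqrt)
    \<comment> \<open>The index 2 is split as \<open>k + 1 + 1\<close> so that
      \<open>LIMSEQ_offset\<close> removes one unit of the shift and leaves
      \<open>k + 1\<close>.\<close>
    then have "(\<lambda>k. norm ((x (k + 1 + 1), v (k + 1 + 1)) - (xs, vs))) \<longlonglongrightarrow> sqrt l"
      by (simp add: V_def norm_Pair)
    then have "(\<lambda>k. norm ((x (k + 1), v (k + 1)) - (xs, vs))) \<longlonglongrightarrow> sqrt l"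
      by (rule LIMSEQ_offset)
    then show "convergent (\<lambda>k. norm ((x (k + 1), v (k + 1)) - (xs, vs)))"
      by (rule convergentI)
    show "\<exists>xbar vbar. seq_cluster_point (\<lambda>k. (x k, v k)) (xbar, vbar) \<and>
        (\<exists>xopt\<in>Xstar. xbar = (\<chi> i. xopt))"
    proof -
      obtain p r where r: "strict_mono (r :: nat \<Rightarrow> nat)" "((\<lambda>k. (x k, v k)) \<circ> r) \<longlonglongrightarrow> p"
        using bounded_imp_convergent_subsequence[OF bdd] by blast
      then have "seq_cluster_point (\<lambda>k. (x k, v k)) (fst p, snd p)"
        by (auto simp: seq_cluster_point_def)
      moreover have "seq_cluster_point x (fst p)"
        using r tendsto_fst[OF r(2)] by (auto simp: seq_cluster_point_def o_def)
      ultimately show ?thesis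
        using cluster by blast
    qed
    show "(\<lambda>k. x k $ i) \<longlonglongrightarrow> xopt" if "Xstar = {xopt}" for xopt i
    proof -
      have "bounded (range x)"
        using bounded_fst[OF bdd] by (simp add: image_image)
      then have "x \<longlonglongrightarrow> (\<chi> i. xopt)"
        using cluster that by (intro bounded_sequence_tendsto_of_unique_cluster_point) auto
      then have "(\<lambda>k. x k $ i) \<longlonglongrightarrow> (\<chi> i. xopt) $ i"
        by (rule tendsto_vec_nth)
      then show ?thesis
        by simp
    qed
  qed (use consensus cost cost_xs in simp_all)
qed

end
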